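(* Let $d\geq 1$ be an integer, let $0<r<1$, and set $p_r:=\frac{2r}{\log_2(2+2^r)}$. Then $$\|f*g\|_{\ell^r(\mathbb{Z}^d)}\geq \|f\|_{\ell^{p_r}(\mathbb{Z}^d)}\, \|g\|_{\ell^{p_r}(\mathbb{Z}^d)}$$ holds for all $f,g:\mathbb{Z}^d\to [0,\infty)$ supported in $\{0,1\}^d$. Moreover, the exponent $p_r$ cannot be replaced by any smaller (positive) real number; that is, for every $0<p<p_r$ the inequality $\|f*g\|_{\ell^r(\mathbb{Z}^d)}\geq \|f\|_{\ell^{p}(\mathbb{Z}^d)} \|g\|_{\ell^{p}(\mathbb{Z}^d)}$ fails for some $f,g:\mathbb{Z}^d\to[0,\infty)$ supported in $\{0,1\}^d$.
   Context: A function $f$ on $\mathbb{Z}^d$ is supported in $\{0,1\}^d$ if $f(x)=0$ for all $x\notin\{0,1\}^d$. Convolution: $(f*g)(x)=\sum_{y\in\mathbb{Z}^d} f(y)g(x-y)$. For every $0<p<\infty$ (including $p<1$), $\|f\|_{\ell^p(\mathbb{Z}^d)}=\big(\sum_{x\in\mathbb{Z}^d}|f(x)|^p\big)^{1/p}$. *)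

theory Defs
  imports "HOL-Analysis.Analysis"
begin

text \<open>The lattice $\mathbb{Z}^d$ is the type \<open>int ^ 'd\<close>, with \<open>d = CARD('d) \<ge> 1\<close>.\<close>

definition discrete_cube :: "(int ^ 'd) set" where
  "discrete_cube = {x. \<forall>i. x $ i \<in> {0, 1}}"

definition supported_in :: "(int ^ 'd \<Rightarrow> real) \<Rightarrow> (int ^ 'd) set \<Rightarrow> bool" where
  "supported_in f A \<longleftrightarrow> (\<forall>x. x \<notin> A \<longrightarrow> f x = 0)"

definition convolution :: "(int ^ 'd \<Rightarrow> real) \<Rightarrow> (int ^ 'd \<Rightarrow> real) \<Rightarrow> int ^ 'd \<Rightarrow> real"
  where "convolution f g x = (\<Sum>\<^sub>\<infinity>y\<in>UNIV. f y * g (x - y))"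

text \<open>
  For \<open>p < 1\<close> this is only a quasi-norm. Since \<open>0 powr p = 0\<close>, points where \<open>f\<close> vanishes
  contribute nothing. Both this sum and the one in the convolution are meaningful only when
  summable (a non-summable \<open>infsum\<close> is \<open>0\<close>), which is automatic for functions supported in a
  finite set such as the discrete cube.
\<close>

definition lp_norm :: "real \<Rightarrow> (int ^ 'd \<Rightarrow> real) \<Rightarrow> real" where
  "lp_norm p f = (\<Sum>\<^sub>\<infinity>x\<in>UNIV. \<bar>f x\<bar> powr p) powr (1 / p)"

definition critical_exponent :: "real \<Rightarrow> real" where
  "critical_exponent r = 2 * r / log 2 (2 + 2 powr r)"

end

theory Submission imports Defs begin

text \<open>
  Put \<open>p = critical_exponent r\<close> and \<open>q = r / p\<close>, so that \<open>4 powr q = 2 + 2 powr r\<close> and \<open>1/2 \<le> q \<le> 1\<close>.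

  The inequality tensorises. Slicing \<open>f\<close> and \<open>g\<close> along one coordinate into \<open>f0, f1\<close> and \<open>g0, g1\<close>, the
  convolution has the three slices \<open>f0 * g0\<close>, \<open>f0 * g1 + f1 * g0\<close> and \<open>f1 * g1\<close>. On nonnegative functions
  the \<open>\<ell>\<^sup>r\<close> quasi-norm with \<open>r \<le> 1\<close> is superadditive (\<open>reverse_Minkowski\<close>), so the inequality for the slices
  reduces the claim to the case of two points (\<open>two_point\<close>): for nonnegative \<open>a, b, c, e\<close>,
  \<open>(a c)^r + (a e + b c)^r + (b e)^r \<ge> ((a^p + b^p) (c^p + e^p))^q\<close>.

  For positive values, homogeneity allows one to write \<open>a e\<close>, \<open>b c\<close> as \<open>exp (\<plusminus>t)\<close> and \<open>b e\<close>, \<open>a c\<close> as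
  \<open>exp (\<plusminus>s)\<close>, and the inequality becomes
  \<open>2 cosh (r s) + (2 cosh t)^r \<ge> (2 cosh (p s) + 2 cosh (p t))^q\<close>,
  with equality at \<open>s = t = 0\<close>. It is the sum of three one-variable estimates, each saying that some
  function attains its minimum at the origin: \<open>(2 cosh t)^r - 2 cosh (r t)\<close> (\<open>powr_cosh_gap\<close>), and,
  for \<open>D \<ge> 2\<close>, \<open>2 cosh (q u) - (2 cosh u + D)^q\<close> (\<open>powr_add_cosh_gap\<close>), the latter used for \<open>u = p s\<close> with
  \<open>D = 2 cosh (p t)\<close> and for \<open>u = p t\<close> with \<open>D = 2\<close>. The signs of all the derivatives come from one
  comparison of \<open>X^k - Y^k\<close> with \<open>(X - Y) (X + Y)^(k - 1)\<close> for \<open>0 < Y \<le> X\<close>: the former is the larger for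
  \<open>1 \<le> k \<le> 2\<close> and the smaller for \<open>0 < k \<le> 1\<close> (\<open>powr_diff_ge\<close>, \<open>powr_diff_le\<close>).

  Sharpness is seen on the indicator of an edge of the cube (\<open>exists_violation\<close>): with a general
  exponent \<open>p'\<close> in place of \<open>p\<close>, the two sides there are \<open>(2 + 2 powr r) powr (1 / r)\<close> and
  \<open>4 powr (1 / p')\<close>; they agree exactly for \<open>p' = p\<close>, and the second is larger for \<open>p' < p\<close>.
\<close>

section \<open>Comparing differences of powers\<close>

text \<open>A function with decreasing derivative is concave, hence lies above its chord.\<close>
lemma chord_le_of_decreasing_derivative:
  fixes m m' :: "real \<Rightarrow> real"
  assumes zero: "m 0 = 0" and cont: "continuous_on {0..1} m"
    and deriv: "\<And>x. 0 < x \<Longrightarrow> x < 1 \<Longrightarrow> (m has_real_derivative m' x) (at x)"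
    and decr: "\<And>x y. 0 < x \<Longrightarrow> x \<le> y \<Longrightarrow> y < 1 \<Longrightarrow> m' y \<le> m' x"
    and h: "0 < h" "h < 1"
  shows "h * m 1 \<le> m h"
proof -
  have c1: "continuous_on {0..h} m" and c2: "continuous_on {h..1} m"
    using cont h by (auto intro: continuous_on_subset)
  have D: "(m has_derivative (*) (m' x)) (at x)" if "0 < x" "x < 1" for x
    using deriv[OF that] by (simp add: has_field_derivative_def)
  obtain x where x: "0 < x" "x < h" "m h - m 0 = m' x * (h - 0)"
    by (rule mvt[OF h(1) c1, of "\<lambda>x. (*) (m' x)"]) (use D h in auto)
  obtain y where y: "h < y" "y < 1" "m 1 - m h = m' y * (1 - h)"
    by (rule mvt[OF h(2) c2, of "\<lambda>x. (*) (m' x)"]) (use D h in auto)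
  have "h * (m 1 - m h) = h * (1 - h) * m' y"
    using y by simp
  also have "\<dots> \<le> h * (1 - h) * m' x"
    using decr[of x y] x y h by (intro mult_left_mono) auto
  also have "\<dots> = (1 - h) * m h"
    using x zero by simp
  finally show ?thesis by (simp add: algebra_simps)
qed

lemma powr_sym_sum_antimono:
  fixes a x y :: real
  assumes "0 \<le> a" "a \<le> 1" "0 < x" "x \<le> y" "y < 1"
  shows "(1 + y) powr a + (1 - y) powr a \<le> (1 + x) powr a + (1 - x) powr a"
proof (rule DERIV_nonpos_imp_nonincreasing[OF assms(4)], intro exI conjI)
  fix t assume t: "x \<le> t" "t \<le> y"
  show "((\<lambda>t. (1 + t) powr a + (1 - t) powr a) has_real_derivative
      a * ((1 + t) powr (a - 1) - (1 - t) powr (a - 1))) (at t)"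
    using t assms by (auto intro!: derivative_eq_intros simp: algebra_simps)
  have "(1 + t) powr (a - 1) \<le> (1 - t) powr (a - 1)"
    using t assms by (intro powr_mono2') auto
  then show "a * ((1 + t) powr (a - 1) - (1 - t) powr (a - 1)) \<le> 0"
    using assms by (simp add: mult_nonneg_nonpos)
qed

lemma powr_sym_sum_mono:
  fixes a x y :: real
  assumes "a \<le> 0" "0 < x" "x \<le> y" "y < 1"
  shows "(1 + x) powr a + (1 - x) powr a \<le> (1 + y) powr a + (1 - y) powr a"
proof (rule DERIV_nonneg_imp_nondecreasing[OF assms(3)], intro exI conjI)
  fix t assume t: "x \<le> t" "t \<le> y"
  show "((\<lambda>t. (1 + t) powr a + (1 - t) powr a) has_real_derivative
      a * ((1 + t) powr (a - 1) - (1 - t) powr (a - 1))) (at t)"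
    using t assms by (auto intro!: derivative_eq_intros simp: algebra_simps)
  have "(1 + t) powr (a - 1) \<le> (1 - t) powr (a - 1)"
    using t assms by (intro powr_mono2') auto
  then show "a * ((1 + t) powr (a - 1) - (1 - t) powr (a - 1)) \<ge> 0"
    using assms by (simp add: mult_nonpos_nonpos)
qed

text \<open>
  Both inequalities are equalities at \<open>h = 0\<close> and \<open>h = 1\<close>. As a function of \<open>h\<close>, the
  difference of powers is concave for \<open>1 \<le> k \<le> 2\<close> and convex for \<open>0 < k \<le> 1\<close>, while the other side
  is its chord.
\<close>
lemma powr_sym_diff:
  fixes k h :: real
  assumes h: "0 < h" "h < 1"
  shows "1 \<le> k \<Longrightarrow> k \<le> 2 \<Longrightarrow> h * 2 powr k \<le> (1 + h) powr k - (1 - h) powr k"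
    and "0 < k \<Longrightarrow> k \<le> 1 \<Longrightarrow> (1 + h) powr k - (1 - h) powr k \<le> h * 2 powr k"
proof -
  let ?m = "\<lambda>x. (1 + x) powr k - (1 - x) powr k"
  let ?m' = "\<lambda>x. k * ((1 + x) powr (k - 1) + (1 - x) powr (k - 1))"
  have cont: "continuous_on {0..1} ?m" if "k > 0"
    using that by (intro continuous_intros continuous_on_powr') auto
  have deriv: "(?m has_real_derivative ?m' x) (at x)" if "0 < x" "x < 1" for x
    using that by (auto intro!: derivative_eq_intros simp: algebra_simps)
  show "h * 2 powr k \<le> ?m h" if k: "1 \<le> k" "k \<le> 2"
    using chord_le_of_decreasing_derivative[of ?m ?m' h] cont deriv h k
      powr_sym_sum_antimono[of "k - 1"] by (simp add: mult_left_mono)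
  show "?m h \<le> h * 2 powr k" if k: "0 < k" "k \<le> 1"
    using chord_le_of_decreasing_derivative[of "\<lambda>x. - ?m x" "\<lambda>x. - ?m' x" h]
      continuous_on_minus[OF cont] DERIV_minus[OF deriv] h k
      powr_sym_sum_mono[of "k - 1"] by (simp add: mult_left_mono)
qed

text \<open>The homogeneous form of the preceding comparison, with \<open>h = (X - Y) / (X + Y)\<close>.\<close>
lemma powr_diff_compare:
  fixes k X Y :: real
  assumes XY: "0 < Y" "Y \<le> X"
  shows powr_diff_ge: "1 \<le> k \<Longrightarrow> k \<le> 2 \<Longrightarrow> (X - Y) * (X + Y) powr (k - 1) \<le> X powr k - Y powr k"
    and powr_diff_le: "0 < k \<Longrightarrow> k \<le> 1 \<Longrightarrow> X powr k - Y powr k \<le> (X - Y) * (X + Y) powr (k - 1)"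
proof -
  define h where "h = (X - Y) / (X + Y)"
  define c where "c = ((X + Y) / 2) powr k"
  have c: "c > 0" using XY by (simp add: c_def)
  have "1 + h = X / ((X + Y) / 2)" "1 - h = Y / ((X + Y) / 2)"
    using XY by (simp_all add: h_def field_simps)
  then have scale: "c * ((1 + h) powr k - (1 - h) powr k) = X powr k - Y powr k"
    using XY c by (simp add: c_def right_diff_distrib powr_divide powr_mult)
  have "c * 2 powr k = (X + Y) powr k"
    using XY by (simp add: c_def powr_divide)
  also have "\<dots> = (X + Y) * (X + Y) powr (k - 1)"
    using XY by (simp add: powr_mult_base)
  finally have "h * (c * 2 powr k) = (X - Y) * (X + Y) powr (k - 1)"
    using XY by (simp add: h_def)
  then have scale': "c * (h * 2 powr k) = (X - Y) * (X + Y) powr (k - 1)"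
    by (simp only: mult.left_commute)
  have h: "0 < h" "h < 1" if "Y \<noteq> X" using XY that by (auto simp: h_def)
  show "(X - Y) * (X + Y) powr (k - 1) \<le> X powr k - Y powr k" if "1 \<le> k" "k \<le> 2"
    using mult_left_mono[OF powr_sym_diff(1)[OF h that], of c] c
    by (cases "Y = X") (auto simp: scale scale')
  show "X powr k - Y powr k \<le> (X - Y) * (X + Y) powr (k - 1)" if "0 < k" "k \<le> 1"
    using mult_left_mono[OF powr_sym_diff(2)[OF h that], of c] c
    by (cases "Y = X") (auto simp: scale scale')
qed

section \<open>The two-point inequality\<close>

text \<open>
  The right-hand side is minimal at \<open>t = 0\<close>. With \<open>X = exp t\<close> and \<open>Y = exp (- t)\<close>, the sign of its
  derivative is given by \<open>powr_diff_le\<close>.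
\<close>
lemma powr_cosh_gap:
  fixes r t :: real
  assumes "0 < r" "r \<le> 1"
  shows "2 powr r - 2 \<le> (exp t + exp (-t)) powr r - exp (r * t) - exp (- r * t)"
proof -
  have *: "2 powr r - 2 \<le> (exp t + exp (-t)) powr r - exp (r * t) - exp (- r * t)"
    if "0 \<le> t" for t
  proof -
    let ?F = "\<lambda>t. (exp t + exp (-t)) powr r - exp (r * t) - exp (- r * t)"
    have "?F 0 \<le> ?F t"
    proof (rule DERIV_nonneg_imp_nondecreasing[OF that], intro exI conjI)
      fix s :: real assume s: "0 \<le> s" "s \<le> t"
      have pos: "0 < exp s + exp (-s)" by (simp add: add_pos_pos)
      show "(?F has_real_derivative r * ((exp s - exp (-s)) * (exp s + exp (-s)) powr (r - 1)
          - (exp (r * s) - exp (- r * s)))) (at s)"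
        using pos by (auto intro!: derivative_eq_intros simp: algebra_simps)
      show "0 \<le> r * ((exp s - exp (-s)) * (exp s + exp (-s)) powr (r - 1)
          - (exp (r * s) - exp (- r * s)))"
        using powr_diff_le[of "exp (-s)" "exp s" r] s assms
        by (simp add: exp_powr_real mult.commute)
    qed
    then show ?thesis by simp
  qed
  show ?thesis
    using *[of t] *[of "-t"] by (cases "0 \<le> t") (auto simp: algebra_simps)
qed

text \<open>
  Again the minimum is at \<open>s = 0\<close>. As \<open>D \<ge> 2\<close> and \<open>q \<le> 1\<close>, the sum \<open>exp u + exp (- u) + D\<close> occurring in the
  derivative at \<open>u\<close> may be replaced by the square of \<open>exp (u/2) + exp (- u/2)\<close>, after which the sign follows
  from \<open>powr_diff_ge\<close> with exponent \<open>2 q\<close>.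
\<close>
lemma powr_add_cosh_gap:
  fixes q D s :: real
  assumes q: "1/2 \<le> q" "q \<le> 1" and D: "2 \<le> D"
  shows "2 - (2 + D) powr q \<le> exp (q * s) + exp (- q * s) - (exp s + exp (-s) + D) powr q"
proof -
  have *: "2 - (2 + D) powr q \<le> exp (q * s) + exp (- q * s) - (exp s + exp (-s) + D) powr q"
    if "0 \<le> s" for s
  proof -
    let ?F = "\<lambda>s. exp (q * s) + exp (- q * s) - (exp s + exp (-s) + D) powr q"
    have "?F 0 \<le> ?F s"
    proof (rule DERIV_nonneg_imp_nondecreasing[OF that], intro exI conjI)
      fix u :: real assume u: "0 \<le> u" "u \<le> s"
      have pos: "0 < exp u + exp (-u) + D" using D by (simp add: add_pos_pos)
      show "(?F has_real_derivative q * ((exp (q * u) - exp (- q * u))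
          - (exp u - exp (-u)) * (exp u + exp (-u) + D) powr (q - 1))) (at u)"
        using pos by (auto intro!: derivative_eq_intros simp: algebra_simps)
      define X Y where "X = exp (u/2)" and "Y = exp (-(u/2))"
      have XY: "0 < Y" "Y \<le> X" using u by (simp_all add: X_def Y_def)
      have sq: "exp u = X\<^sup>2" "exp (-u) = Y\<^sup>2" "X * Y = 1"
        by (simp_all add: X_def Y_def power2_eq_square flip: exp_add)
      have "(exp u + exp (-u) + D) powr (q - 1) \<le> ((X + Y)\<^sup>2) powr (q - 1)"
      proof (rule powr_mono2')
        show "0 < (X + Y)\<^sup>2" using XY by simp
        show "(X + Y)\<^sup>2 \<le> exp u + exp (-u) + D"
          using sq D by (simp add: power2_sum)
      qed (use q in simp)
      also have "\<dots> = (X + Y) powr (2 * (q - 1))"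
        using XY by (simp add: powr_powr flip: powr_numeral)
      finally have "(exp u - exp (-u)) * (exp u + exp (-u) + D) powr (q - 1)
          \<le> (exp u - exp (-u)) * (X + Y) powr (2 * (q - 1))"
        using u by (intro mult_left_mono) auto
      also have "\<dots> = (X - Y) * ((X + Y) * (X + Y) powr (2 * (q - 1)))"
        by (simp add: sq power2_eq_square algebra_simps)
      also have "\<dots> = (X - Y) * (X + Y) powr (2 * q - 1)"
        using XY by (simp add: powr_mult_base)
      also have "\<dots> \<le> X powr (2 * q) - Y powr (2 * q)"
        using XY q by (intro powr_diff_ge) auto
      also have "\<dots> = exp (q * u) - exp (- q * u)"
        by (simp add: X_def Y_def exp_powr_real mult.commute)
      finally show "0 \<le> q * ((exp (q * u) - exp (- q * u))
          - (exp u - exp (-u)) * (exp u + exp (-u) + D) powr (q - 1))"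
        using q by simp
    qed
    then show ?thesis by simp
  qed
  show ?thesis
    using *[of s] *[of "-s"] by (cases "0 \<le> s") (auto simp: algebra_simps)
qed

lemma powr_add_le_powr:
  fixes s t q :: real
  assumes q: "0 < q" "q \<le> 1" and st: "0 \<le> s" "0 \<le> t"
  shows "(s + t) powr q \<le> s powr q + t powr q"
proof (cases "s + t = 0")
  case False
  define c where "c = s + t"
  have c: "c > 0" using False st by (simp add: c_def)
  have *: "x / c * c powr q \<le> x powr q" if "0 \<le> x" "x \<le> c" for x
  proof -
    have "x / c \<le> (x / c) powr q"
      using powr_mono'[of q 1 "x / c"] q c that by simp
    then have "x / c * c powr q \<le> (x / c) powr q * c powr q"
      by (intro mult_right_mono) auto
    also have "\<dots> = x powr q"
      using c that by (simp flip: powr_mult)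
    finally show ?thesis .
  qed
  have "c powr q = s / c * c powr q + t / c * c powr q"
    using c by (simp add: c_def flip: distrib_right add_divide_distrib)
  also have "\<dots> \<le> s powr q + t powr q"
    using st by (intro add_mono *) (auto simp: c_def)
  finally show ?thesis by (simp add: c_def)
qed (use st in auto)

text \<open>
  The two-point inequality in exponential coordinates. Starting from the left-hand side, \<open>s\<close> is removed
  first (with \<open>D = exp (p t) + exp (- p t)\<close>), then \<open>t\<close> (with \<open>D = 2\<close>); the resulting
  \<open>exp (r t) + exp (- r t)\<close> is absorbed by \<open>powr_cosh_gap\<close>. Equality holds at \<open>s = t = 0\<close>.
\<close>
lemma two_point_exp:
  fixes p q r s t :: real
  assumes r: "0 < r" "r \<le> 1" and q: "1/2 \<le> q" "q \<le> 1" and qp: "q * p = r"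
    and crit: "4 powr q = 2 + 2 powr r"
  shows "(exp (p * s) + exp (- p * s) + (exp (p * t) + exp (- p * t))) powr q
      \<le> exp (r * s) + exp (- r * s) + (exp t + exp (-t)) powr r"
proof -
  have two_le: "2 \<le> exp x + exp (-x)" for x :: real
  proof -
    have "0 \<le> (exp (x/2) - exp (-(x/2)))\<^sup>2" by simp
    then show ?thesis
      by (simp add: power2_eq_square algebra_simps flip: exp_add)
  qed
  have qp': "q * (p * x) = r * x" for x
    using qp by (simp flip: mult.assoc)
  have "(exp (p * s) + exp (- (p * s)) + (exp (p * t) + exp (- (p * t)))) powr q
      \<le> exp (r * s) + exp (- (r * s)) - 2 + (2 + (exp (p * t) + exp (- (p * t)))) powr q"
    using powr_add_cosh_gap[OF q two_le, of "p * t" "p * s"] by (simp add: qp')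
  moreover have "(2 + (exp (p * t) + exp (- (p * t)))) powr q
      \<le> exp (r * t) + exp (- (r * t)) - 2 + 4 powr q"
    using powr_add_cosh_gap[OF q order_refl, of "p * t"] by (simp add: qp' add.commute[of 2])
  moreover have "exp (r * t) + exp (- (r * t)) \<le> (exp t + exp (-t)) powr r - 2 powr r + 2"
    using powr_cosh_gap[OF r, of t] by simp
  ultimately show ?thesis using crit by simp
qed

text \<open>
  The case of functions \<open>(a, b)\<close> and \<open>(c, e)\<close> on \<open>{0, 1}\<close>, raised to the power \<open>r\<close>. The products
  \<open>a e\<close>, \<open>b c\<close> and \<open>b e\<close>, \<open>a c\<close> are pairs with the same product, hence of the form \<open>M exp (\<plusminus>t)\<close> and
  \<open>M exp (\<plusminus>s)\<close>. If one of the four values vanishes, only subadditivity of \<open>x powr q\<close> is needed.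
\<close>
lemma two_point:
  fixes a b c e p q r :: real
  assumes r: "0 < r" "r \<le> 1" and q: "1/2 \<le> q" "q \<le> 1" and qp: "q * p = r"
    and crit: "4 powr q = 2 + 2 powr r"
    and nonneg: "0 \<le> a" "0 \<le> b" "0 \<le> c" "0 \<le> e"
  shows "((a powr p + b powr p) * (c powr p + e powr p)) powr q
      \<le> (a * c) powr r + (a * e + b * c) powr r + (b * e) powr r"
proof -
  have pq: "p * q = r" using qp by (simp add: mult.commute)
  have one_zero: "(x powr p * (y powr p + z powr p)) powr q \<le> (x * y) powr r + (x * z) powr r"
    if "0 \<le> y" "0 \<le> z" for x y z
  proof -
    have "(x powr p * (y powr p + z powr p)) powr q = x powr r * (y powr p + z powr p) powr q"
      by (simp add: powr_mult powr_powr pq)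
    also have "\<dots> \<le> x powr r * ((y powr p) powr q + (z powr p) powr q)"
      using q by (intro mult_left_mono powr_add_le_powr) auto
    also have "\<dots> = (x * y) powr r + (x * z) powr r"
      by (simp add: powr_mult powr_powr pq distrib_left)
    finally show ?thesis .
  qed
  consider "a = 0" | "b = 0" | "c = 0" | "e = 0" | "0 < a" "0 < b" "0 < c" "0 < e"
    using nonneg by fastforce
  then show ?thesis
  proof cases
    case 1 then show ?thesis using one_zero[of c e b] nonneg by simp
  next
    case 2 then show ?thesis using one_zero[of c e a] nonneg by simp
  next
    case 3 then show ?thesis using one_zero[of a b e] nonneg by (simp add: ac_simps)
  next
    case 4 then show ?thesis using one_zero[of a b c] nonneg by (simp add: ac_simps)
  next
    case 5
    define M where "M = sqrt (a * b * c * e)"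
    define t where "t = ln (a * e / M)"
    define s where "s = ln (b * e / M)"
    have M: "M > 0" "M * M = a * b * c * e" using 5 by (simp_all add: M_def)
    have ae: "a * e = M * exp t" and be: "b * e = M * exp s"
      using 5 M by (simp_all add: t_def s_def)
    have bc: "b * c = M * exp (-t)" and ac: "a * c = M * exp (-s)"
      using 5 M by (simp_all add: t_def s_def exp_minus field_simps)
    have mexp: "(M * exp x) powr y = M powr y * exp (y * x)" for x y
      by (simp add: powr_mult exp_powr_real mult.commute)
    have "(a powr p + b powr p) * (c powr p + e powr p)
        = (b * e) powr p + (a * c) powr p + ((a * e) powr p + (b * c) powr p)"
      by (simp add: powr_mult algebra_simps)
    also have "\<dots> = M powr p * (exp (p * s) + exp (- p * s) + (exp (p * t) + exp (- p * t)))"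
      unfolding ae be bc ac mexp by (simp add: algebra_simps)
    finally have "((a powr p + b powr p) * (c powr p + e powr p)) powr q
        = M powr r * (exp (p * s) + exp (- p * s) + (exp (p * t) + exp (- p * t))) powr q"
      by (simp add: powr_mult powr_powr pq)
    also have "\<dots> \<le> M powr r * (exp (r * s) + exp (- r * s) + (exp t + exp (-t)) powr r)"
      by (intro mult_left_mono two_point_exp r q qp crit) auto
    also have "\<dots> = (a * c) powr r + (a * e + b * c) powr r + (b * e) powr r"
    proof -
      have "a * e + b * c = M * (exp t + exp (-t))"
        unfolding ae bc by (simp add: algebra_simps)
      then have "(a * e + b * c) powr r = M powr r * (exp t + exp (-t)) powr r"
        by (simp only: powr_mult)
      then show ?thesis
        unfolding be ac mexp by (simp add: distrib_left)
    qed
    finally show ?thesis .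
  qed
qed

section \<open>Superadditivity of the quasi-norm\<close>

lemma powr_concave:
  fixes r x y l :: real
  assumes r: "0 < r" "r \<le> 1" and xy: "0 \<le> x" "0 \<le> y" and l: "0 \<le> l" "l \<le> 1"
  shows "l * x powr r + (1 - l) * y powr r \<le> (l * x + (1 - l) * y) powr r"
proof -
  have zero: "m * z powr r \<le> (m * z) powr r" if "0 \<le> m" "m \<le> 1" for m z
    using powr_mono'[of r 1 m] r that by (simp add: powr_mult mult_right_mono)
  consider "x = 0" | "y = 0" | "0 < x" "0 < y" using xy by fastforce
  then show ?thesis
  proof cases
    case 1 then show ?thesis using zero[of "1 - l" y] l by simp
  next
    case 2 then show ?thesis using zero[of l x] l by simp
  next
    case 3
    have "convex_on {0<..} (\<lambda>z::real. z powr (1 / r))"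
      using r by (intro powr_convex) auto
    \<comment> \<open>The inverse function \<open>z powr (1 / r)\<close> is convex; its inequality at \<open>x powr r\<close> and \<open>y powr r\<close> is inverted.\<close>
    from convex_onD[OF this, of "1 - l" "x powr r" "y powr r"]
    have "(l * x powr r + (1 - l) * y powr r) powr (1 / r) \<le> l * x + (1 - l) * y"
      using r l 3 by (simp add: powr_powr)
    then have "((l * x powr r + (1 - l) * y powr r) powr (1 / r)) powr r
        \<le> (l * x + (1 - l) * y) powr r"
      using r by (intro powr_mono2) auto
    then show ?thesis
      using r l by (simp add: powr_powr)
  qed
qed

lemma reverse_Minkowski_sum:
  fixes u v :: "'a \<Rightarrow> real" and r :: real
  assumes r: "0 < r" "r \<le> 1" and fin: "finite A"
    and nonneg: "\<And>x. 0 \<le> u x" "\<And>x. 0 \<le> v x"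
  shows "((\<Sum>x\<in>A. u x powr r) powr (1 / r) + (\<Sum>x\<in>A. v x powr r) powr (1 / r)) powr r
      \<le> (\<Sum>x\<in>A. (u x + v x) powr r)"
proof -
  define U where "U = (\<Sum>x\<in>A. u x powr r) powr (1 / r)"
  define V where "V = (\<Sum>x\<in>A. v x powr r) powr (1 / r)"
  have Ur: "U powr r = (\<Sum>x\<in>A. u x powr r)" and Vr: "V powr r = (\<Sum>x\<in>A. v x powr r)"
    using r by (simp_all add: U_def V_def powr_powr sum_nonneg)
  have UV: "0 \<le> U" "0 \<le> V" by (simp_all add: U_def V_def)
  consider "U = 0" | "V = 0" | "0 < U" "0 < V" using UV by fastforce
  then have "(U + V) powr r \<le> (\<Sum>x\<in>A. (u x + v x) powr r)"
  proof cases
    case 1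
    have "V powr r \<le> (\<Sum>x\<in>A. (u x + v x) powr r)"
      unfolding Vr using r nonneg by (intro sum_mono powr_mono2) auto
    then show ?thesis using 1 by simp
  next
    case 2
    have "U powr r \<le> (\<Sum>x\<in>A. (u x + v x) powr r)"
      unfolding Ur using r nonneg by (intro sum_mono powr_mono2) auto
    then show ?thesis using 2 by simp
  next
    case 3
    \<comment> \<open>The function \<open>u + v\<close> is \<open>U + V\<close> times the convex combination of \<open>u / U\<close> and \<open>v / V\<close> with weight \<open>l\<close>.\<close>
    define l where "l = U / (U + V)"
    have l: "0 \<le> l" "l \<le> 1" and l': "1 - l = V / (U + V)"
      using 3 by (auto simp: l_def field_simps)
    have "(U + V) powr r = (U + V) powr r * (l + (1 - l))"
      by simp
    also have "\<dots> = (\<Sum>x\<in>A. (U + V) powr r * (l * (u x / U) powr r + (1 - l) * (v x / V) powr r))"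
      using 3 nonneg
      by (simp add: powr_divide sum.distrib flip: sum_distrib_left sum_divide_distrib Ur Vr)
    also have "\<dots> \<le> (\<Sum>x\<in>A. (U + V) powr r * (l * (u x / U) + (1 - l) * (v x / V)) powr r)"
      using 3 nonneg l r by (intro sum_mono mult_left_mono powr_concave) auto
    also have "\<dots> = (\<Sum>x\<in>A. (u x + v x) powr r)"
    proof (rule sum.cong[OF refl])
      fix x
      have "l * (u x / U) + (1 - l) * (v x / V) = (u x + v x) / (U + V)"
        unfolding l' unfolding l_def using 3 by (simp add: add_divide_distrib)
      then have "(U + V) * (l * (u x / U) + (1 - l) * (v x / V)) = u x + v x"
        using 3 by simp
      then show "(U + V) powr r * (l * (u x / U) + (1 - l) * (v x / V)) powr r = (u x + v x) powr r"
        by (simp flip: powr_mult)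
    qed
    finally show ?thesis .
  qed
  then show ?thesis by (simp add: U_def V_def)
qed

section \<open>Power sums and convolutions of finitely supported functions\<close>

abbreviation finite_support :: "('a \<Rightarrow> real) \<Rightarrow> bool" where
  "finite_support f \<equiv> finite {x. f x \<noteq> 0}"

text \<open>
  The \<open>p\<close>-th power of the \<open>\<ell>\<^sup>p\<close> quasi-norm. Unlike the quasi-norm, it is additive over finitely supported functions
  with disjoint supports. As with any infinite sum, its value is \<open>0\<close> when the series diverges.
\<close>
definition power_sum :: "real \<Rightarrow> ('a \<Rightarrow> real) \<Rightarrow> real" where
  "power_sum p f = (\<Sum>\<^sub>\<infinity>x\<in>UNIV. \<bar>f x\<bar> powr p)"

text \<open>The function \<open>f\<close> moved by the vector \<open>v\<close>, so that its support moves by \<open>+ v\<close>.\<close>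
definition translate :: "int ^ 'd \<Rightarrow> (int ^ 'd \<Rightarrow> real) \<Rightarrow> int ^ 'd \<Rightarrow> real" where
  "translate v f x = f (x - v)"

lemma lp_norm_eq_power_sum: "lp_norm p f = power_sum p f powr (1 / p)"
  by (simp add: lp_norm_def power_sum_def)

lemma power_sum_nonneg: "0 \<le> power_sum p f"
  by (simp add: power_sum_def infsum_nonneg)

lemma lp_norm_nonneg: "0 \<le> lp_norm p f"
  by (simp add: lp_norm_def)

lemma lp_norm_powr: "p \<noteq> 0 \<Longrightarrow> lp_norm p f powr p = power_sum p f"
  by (simp add: lp_norm_eq_power_sum powr_powr power_sum_nonneg)

lemma power_sum_eq_sum:
  assumes "finite A" "\<And>x. x \<notin> A \<Longrightarrow> f x = 0"
  shows "power_sum p f = (\<Sum>x\<in>A. \<bar>f x\<bar> powr p)"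
proof -
  have "power_sum p f = infsum (\<lambda>x. \<bar>f x\<bar> powr p) A"
    unfolding power_sum_def using assms by (intro infsum_cong_neutral) auto
  then show ?thesis using assms by simp
qed

lemma power_sum_translate: "power_sum p (translate v f) = power_sum p f"
  unfolding power_sum_def translate_def
  by (rule infsum_reindex_bij_witness[where i = "\<lambda>x. x + v" and j = "\<lambda>x. x - v"]) auto

lemma power_sum_add_disjoint:
  assumes "finite_support f" "finite_support g" and disj: "\<And>x. f x = 0 \<or> g x = 0"
  shows "power_sum p (\<lambda>x. f x + g x) = power_sum p f + power_sum p g"
proof -
  have "\<bar>f x + g x\<bar> powr p = \<bar>f x\<bar> powr p + \<bar>g x\<bar> powr p" for x
    using disj[of x] by auto
  then have "power_sum p (\<lambda>x. f x + g x) = (\<Sum>\<^sub>\<infinity>x. \<bar>f x\<bar> powr p + \<bar>g x\<bar> powr p)"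
    by (simp add: power_sum_def)
  also have "\<dots> = power_sum p f + power_sum p g"
    unfolding power_sum_def using assms
    by (intro infsum_add finite_nonzero_values_imp_summable_on) auto
  finally show ?thesis .
qed

text \<open>
  Superadditivity of the \<open>\<ell>\<^sup>r\<close> quasi-norm on nonnegative functions for \<open>r \<le> 1\<close>, raised to the power \<open>r\<close>.
\<close>
lemma reverse_Minkowski:
  assumes r: "0 < r" "r \<le> 1" and fin: "finite_support u" "finite_support v"
    and nonneg: "\<And>x. 0 \<le> u x" "\<And>x. 0 \<le> v x"
  shows "(lp_norm r u + lp_norm r v) powr r \<le> power_sum r (\<lambda>x. u x + v x)"
proof -
  let ?A = "{x. u x \<noteq> 0} \<union> {x. v x \<noteq> 0}"
  have A: "finite ?A" using fin by simp
  have eq: "power_sum r h = (\<Sum>x\<in>?A. h x powr r)"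
    if "\<And>x. x \<notin> ?A \<Longrightarrow> h x = 0" "\<And>x. 0 \<le> h x" for h
    using power_sum_eq_sum[OF A that(1), where p = r] that(2) by simp
  have "((\<Sum>x\<in>?A. u x powr r) powr (1 / r) + (\<Sum>x\<in>?A. v x powr r) powr (1 / r)) powr r
      \<le> (\<Sum>x\<in>?A. (u x + v x) powr r)"
    by (rule reverse_Minkowski_sum[OF r A nonneg])
  then show ?thesis
    unfolding lp_norm_eq_power_sum by (subst (1 2 3) eq) (use nonneg in auto)
qed

lemma convolution_summable:
  assumes "finite_support f" shows "(\<lambda>y. f y * h y) summable_on UNIV"
  by (rule finite_nonzero_values_imp_summable_on, rule finite_subset[OF _ assms]) auto

lemma convolution_nonneg:
  assumes "\<And>x. 0 \<le> f x" "\<And>x. 0 \<le> g x"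
  shows "0 \<le> convolution f g x"
  unfolding convolution_def using assms by (intro infsum_nonneg) auto

lemma convolution_nonzeroE:
  assumes "convolution f g x \<noteq> 0"
  obtains y z where "f y \<noteq> 0" "g z \<noteq> 0" "x = y + z"
proof -
  have "\<exists>y. f y * g (x - y) \<noteq> 0"
  proof (rule ccontr)
    assume "\<nexists>y. f y * g (x - y) \<noteq> 0"
    then have "(\<lambda>y. f y * g (x - y)) = (\<lambda>y. 0)" by auto
    with assms show False by (simp add: convolution_def)
  qed
  then obtain y where "f y \<noteq> 0" "g (x - y) \<noteq> 0" by auto
  then show ?thesis by (intro that[of y "x - y"]) auto
qed

lemma finite_support_convolution:
  assumes "finite_support f" "finite_support g"
  shows "finite_support (convolution f g)"
proof (rule finite_subset)
  show "{x. convolution f g x \<noteq> 0} \<subseteq> (\<lambda>(y, z). y + z) ` ({x. f x \<noteq> 0} \<times> {x. g x \<noteq> 0})"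
    by (force elim: convolution_nonzeroE)
  show "finite \<dots>" using assms by simp
qed

lemma finite_support_add:
  "finite_support f \<Longrightarrow> finite_support g \<Longrightarrow> finite_support (\<lambda>x. f x + g x)"
  by (rule finite_subset[of _ "{x. f x \<noteq> 0} \<union> {x. g x \<noteq> 0}"]) auto

lemma finite_support_translate:
  assumes "finite_support f" shows "finite_support (translate v f)"
proof (rule finite_subset)
  show "{x. translate v f x \<noteq> 0} \<subseteq> (\<lambda>x. x + v) ` {x. f x \<noteq> 0}"
    by (auto simp: translate_def image_iff) (metis diff_add_cancel)
qed (use assms in simp)

lemma convolution_add_left:
  assumes "finite_support f" "finite_support f'"
  shows "convolution (\<lambda>x. f x + f' x) g = (\<lambda>x. convolution f g x + convolution f' g x)"
  unfolding convolution_def distrib_right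
  by (intro ext infsum_add convolution_summable assms)

lemma convolution_add_right:
  assumes "finite_support f"
  shows "convolution f (\<lambda>x. g x + g' x) = (\<lambda>x. convolution f g x + convolution f g' x)"
  unfolding convolution_def distrib_left
  by (intro ext infsum_add convolution_summable assms)

lemma convolution_translate_left: "convolution (translate v f) g = translate v (convolution f g)"
  unfolding convolution_def translate_def fun_eq_iff
  by (intro allI infsum_reindex_bij_witness[where i = "\<lambda>x. x + v" and j = "\<lambda>x. x - v"])
     (auto simp: algebra_simps)

lemma convolution_translate_right: "convolution f (translate v g) = translate v (convolution f g)"
  by (simp add: convolution_def translate_def fun_eq_iff algebra_simps)

lemma translate_add: "translate v (\<lambda>x. f x + g x) = (\<lambda>x. translate v f x + translate v g x)"
  by (simp add: translate_def fun_eq_iff)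

section \<open>Slicing along one coordinate\<close>

text \<open>
  The function whose slices at heights \<open>0\<close> and \<open>1\<close> in direction \<open>i\<close> are \<open>f0\<close> and \<open>f1\<close>. This reading is
  justified only when both lie in the hyperplane \<open>x $ i = 0\<close>; a slice is thus stored as a function on
  the same lattice, which keeps the dimension fixed.
\<close>
definition stack :: "'d \<Rightarrow> (int ^ 'd \<Rightarrow> real) \<Rightarrow> (int ^ 'd \<Rightarrow> real) \<Rightarrow> int ^ 'd \<Rightarrow> real" where
  "stack i f0 f1 x = f0 x + translate (axis i 1) f1 x"

text \<open>\<open>f\<close> is finitely supported and lives on the hyperplane where the coordinate \<open>i\<close> equals \<open>c\<close>.\<close>
definition on_level :: "'d \<Rightarrow> int \<Rightarrow> (int ^ 'd \<Rightarrow> real) \<Rightarrow> bool" where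
  "on_level i c f \<longleftrightarrow> finite_support f \<and> (\<forall>x. f x \<noteq> 0 \<longrightarrow> x $ i = c)"

lemma on_level_finite: "on_level i c f \<Longrightarrow> finite_support f"
  by (simp add: on_level_def)

lemma on_level_zero: "on_level i c f \<Longrightarrow> x $ i \<noteq> c \<Longrightarrow> f x = 0"
  by (auto simp: on_level_def)

lemma on_level_convolution:
  assumes "on_level i c f" "on_level i c' g"
  shows "on_level i (c + c') (convolution f g)"
  using assms by (auto simp: on_level_def finite_support_convolution elim: convolution_nonzeroE)

lemma on_level_add:
  assumes "on_level i c f" "on_level i c g"
  shows "on_level i c (\<lambda>x. f x + g x)"
proof -
  have "x $ i = c" if "f x + g x \<noteq> 0" for x
    using assms that by (cases "f x = 0") (auto simp: on_level_def)
  then show ?thesis using assms by (simp add: on_level_def finite_support_add)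
qed

lemma on_level_translate:
  assumes "on_level i c f" shows "on_level i (c + 1) (translate (axis i 1) f)"
proof -
  have "x $ i = c + 1" if "f (x - axis i 1) \<noteq> 0" for x
  proof -
    have "(x - axis i 1) $ i = c" using assms that unfolding on_level_def by blast
    then show ?thesis by simp
  qed
  then show ?thesis
    using assms finite_support_translate[of f "axis i 1"] by (simp add: on_level_def translate_def)
qed

lemma power_sum_stack:
  assumes "on_level i 0 f0" "on_level i 0 f1"
  shows "power_sum p (stack i f0 f1) = power_sum p f0 + power_sum p f1"
proof -
  have "on_level i 1 (translate (axis i 1) f1)"
    using on_level_translate[OF assms(2)] by simp
  then have "power_sum p (stack i f0 f1) = power_sum p f0 + power_sum p (translate (axis i 1) f1)"
    unfolding stack_def using assms(1)
    by (intro power_sum_add_disjoint) (auto dest: on_level_finite, metis on_level_zero zero_neq_one)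
  then show ?thesis by (simp add: power_sum_translate)
qed

text \<open>
  The convolution of two stacks has three slices, at heights \<open>0\<close>, \<open>1\<close> and \<open>2\<close>; this has the same shape as
  the convolution of two functions on \<open>{0, 1}\<close>.
\<close>
lemma power_sum_convolution_stack:
  assumes f: "on_level i 0 f0" "on_level i 0 f1" and g: "on_level i 0 g0" "on_level i 0 g1"
  shows "power_sum p (convolution (stack i f0 f1) (stack i g0 g1))
      = power_sum p (convolution f0 g0)
        + power_sum p (\<lambda>x. convolution f0 g1 x + convolution f1 g0 x)
        + power_sum p (convolution f1 g1)"
proof -
  let ?T = "translate (axis i 1)"
  let ?a = "convolution f0 g0" and ?c = "convolution f1 g1"
  let ?b = "\<lambda>x. convolution f0 g1 x + convolution f1 g0 x"
  have fin: "finite_support f0" "finite_support f1"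
    using f by (auto simp: on_level_def)
  have "on_level i 0 ?a" "on_level i 0 ?b" "on_level i 0 ?c"
    using f g on_level_convolution[where c = 0 and c' = 0 and i = i] by (auto intro!: on_level_add)
  then have level: "on_level i 0 ?a" "on_level i 1 (?T ?b)" "on_level i 2 (?T (?T ?c))"
    using on_level_translate[of i 0 ?b] on_level_translate[OF on_level_translate[of i 0 ?c]]
    by simp_all
  have "convolution (stack i f0 f1) (stack i g0 g1) = (\<lambda>x. ?a x + (?T ?b x + ?T (?T ?c) x))"
    unfolding stack_def
    by (simp add: convolution_add_left convolution_add_right fin finite_support_translate
        convolution_translate_left convolution_translate_right translate_add ac_simps)
  moreover have "power_sum p (\<lambda>x. ?a x + (?T ?b x + ?T (?T ?c) x))
      = power_sum p ?a + power_sum p (\<lambda>x. ?T ?b x + ?T (?T ?c) x)"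
  proof (intro power_sum_add_disjoint finite_support_add)
    show "?a x = 0 \<or> ?T ?b x + ?T (?T ?c) x = 0" for x
      using level[THEN on_level_zero, of x] by (cases "x $ i = 0") auto
  qed (use level in \<open>auto dest: on_level_finite\<close>)
  moreover have "power_sum p (\<lambda>x. ?T ?b x + ?T (?T ?c) x)
      = power_sum p (?T ?b) + power_sum p (?T (?T ?c))"
  proof (intro power_sum_add_disjoint)
    show "?T ?b x = 0 \<or> ?T (?T ?c) x = 0" for x
      using level[THEN on_level_zero, of x] by (cases "x $ i = 1") auto
  qed (use level in \<open>auto dest: on_level_finite\<close>)
  ultimately show ?thesis by (simp add: power_sum_translate)
qed

section \<open>From two points to the cube\<close>

text \<open>
  The face of the discrete cube spanned by the coordinates in \<open>S\<close>. Enlarging \<open>S\<close> one element at a time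
  replaces an induction on the dimension, which is not available for a dimension given by a type.
\<close>
definition subcube :: "'d set \<Rightarrow> (int ^ 'd) set" where
  "subcube S = {x. \<forall>i. x $ i \<in> (if i \<in> S then {0, 1} else {0})}"

lemma finite_subcube: "finite (subcube (S :: 'd::finite set))"
proof (rule finite_subset)
  show "subcube S \<subseteq> (\<lambda>T. \<chi> i. if i \<in> T then 1 else 0) ` UNIV"
  proof
    fix x :: "int ^ 'd" assume "x \<in> subcube S"
    then have "x = (\<chi> i. if i \<in> {i. x $ i = 1} then 1 else 0)"
      by (auto simp: subcube_def vec_eq_iff split: if_splits)
    then show "x \<in> (\<lambda>T. \<chi> i. if i \<in> T then 1 else 0) ` UNIV" by blast
  qed
qed simp

lemma supported_in_subcube_insert:
  assumes f: "supported_in f (subcube (insert i S))" and "i \<notin> S" "\<And>x. 0 \<le> f x"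
  obtains f0 f1 where "f = stack i f0 f1"
    "supported_in f0 (subcube S)" "supported_in f1 (subcube S)"
    "\<And>x. 0 \<le> f0 x" "\<And>x. 0 \<le> f1 x"
proof -
  let ?f0 = "\<lambda>x. if x $ i = 0 then f x else 0"
  let ?f1 = "\<lambda>x. if x $ i = 0 then f (x + axis i 1) else 0"
  have zero: "f x = 0" if "j \<noteq> i" "j \<notin> S" "x $ j \<noteq> 0" for x j
  proof -
    have "x \<notin> subcube (insert i S)"
      using that by (auto simp: subcube_def intro!: exI[of _ j])
    then show ?thesis using f by (simp add: supported_in_def)
  qed
  have zero': "f x = 0" if "x $ j \<noteq> 0" "x $ j \<noteq> 1" for x j
    using f that by (force simp: supported_in_def subcube_def split: if_splits)
  have "f = stack i ?f0 ?f1"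
    using zero' by (auto simp: fun_eq_iff stack_def translate_def)
  moreover have "supported_in ?f0 (subcube S)"
    using zero zero' assms(2) by (auto simp: supported_in_def subcube_def split: if_splits) metis+
  moreover have "supported_in ?f1 (subcube S)"
    unfolding supported_in_def
  proof (intro allI impI)
    fix x :: "int ^ 'a" assume "x \<notin> subcube S"
    then obtain j where j: "x $ j \<notin> (if j \<in> S then {0, 1} else {0})"
      by (auto simp: subcube_def)
    show "?f1 x = 0"
    proof (cases "j = i")
      case False
      then have "(x + axis i 1) $ j = x $ j" by (simp add: axis_def)
      then show ?thesis using j zero[OF False, of "x + axis i 1"] zero'[of "x + axis i 1" j]
        by (auto split: if_splits)
    qed (use j assms(2) in auto)
  qed
  ultimately show thesis using assms(3) by (intro that[of ?f0 ?f1]) auto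
qed

lemma subcube_on_level:
  assumes "supported_in f (subcube S)" "i \<notin> S"
  shows "on_level i 0 f"
proof -
  have "{x. f x \<noteq> 0} \<subseteq> subcube S"
    using assms by (auto simp: supported_in_def)
  moreover from this have "finite_support f"
    by (rule finite_subset[OF _ finite_subcube])
  moreover have "x $ i = 0" if "x \<in> subcube S" for x
    using that assms(2) by (auto simp: subcube_def dest: spec[of _ i])
  ultimately show ?thesis
    by (auto simp: on_level_def)
qed

lemma lp_norm_point:
  assumes "supported_in f {v}" "0 \<le> f v" "p \<noteq> 0"
  shows "lp_norm p f = f v"
  using power_sum_eq_sum[of "{v}" f p] assms
  by (simp add: lp_norm_eq_power_sum supported_in_def powr_powr)

lemma convolution_point:
  assumes "supported_in f {0}"
  shows "convolution f g x = f 0 * g x"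
proof -
  have "convolution f g x = infsum (\<lambda>y. f y * g (x - y)) {0}"
    unfolding convolution_def using assms by (intro infsum_cong_neutral) (auto simp: supported_in_def)
  then show ?thesis by simp
qed

text \<open>
  In the induction step, the two-point inequality is applied to the quasi-norms of the slices of \<open>f\<close>
  and \<open>g\<close>. The middle slice of \<open>f * g\<close> is a sum of two convolutions; superadditivity of the
  \<open>\<ell>\<^sup>r\<close> quasi-norm goes in the needed direction because \<open>r \<le> 1\<close>.
\<close>
lemma lp_norm_convolution_subcube:
  fixes f g :: "int ^ 'd \<Rightarrow> real"
  assumes r: "0 < r" "r \<le> 1" and q: "1/2 \<le> q" "q \<le> 1" and qp: "q * p = r"
    and crit: "4 powr q = 2 + 2 powr r"
    and "finite S" "\<And>x. 0 \<le> f x" "\<And>x. 0 \<le> g x"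
    and "supported_in f (subcube S)" "supported_in g (subcube S)"
  shows "lp_norm p f * lp_norm p g \<le> lp_norm r (convolution f g)"
  using assms(7-)
proof (induction S arbitrary: f g rule: finite_induct)
  case empty
  have p: "p \<noteq> 0" using r qp by auto
  have "subcube {} = {0 :: int ^ 'd}" by (auto simp: subcube_def vec_eq_iff)
  then have supp: "supported_in f {0}" "supported_in g {0}" using empty by auto
  have "supported_in (convolution f g) {0}"
    using supp by (auto simp: convolution_point supported_in_def)
  then have "lp_norm r (convolution f g) = f 0 * g 0"
    using r supp empty by (subst lp_norm_point) (auto simp: convolution_point)
  then show ?case using supp p empty by (simp add: lp_norm_point)
next
  case (insert i S)
  have p: "p \<noteq> 0" using r qp by auto
  have r_div_p: "r * (1 / p) = q" using qp p by (simp add: field_simps)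
  obtain f0 f1 where f: "f = stack i f0 f1" "supported_in f0 (subcube S)" "supported_in f1 (subcube S)"
    "\<And>x. 0 \<le> f0 x" "\<And>x. 0 \<le> f1 x"
    using supported_in_subcube_insert[OF insert.prems(3) insert.hyps(2) insert.prems(1)] by blast
  obtain g0 g1 where g: "g = stack i g0 g1" "supported_in g0 (subcube S)" "supported_in g1 (subcube S)"
    "\<And>x. 0 \<le> g0 x" "\<And>x. 0 \<le> g1 x"
    using supported_in_subcube_insert[OF insert.prems(4) insert.hyps(2) insert.prems(2)] by blast
  have level: "on_level i 0 f0" "on_level i 0 f1" "on_level i 0 g0" "on_level i 0 g1"
    using f g insert.hyps subcube_on_level by auto
  let ?a = "lp_norm p f0" and ?b = "lp_norm p f1" and ?c = "lp_norm p g0" and ?e = "lp_norm p g1"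
  have IH: "lp_norm p u * lp_norm p v \<le> lp_norm r (convolution u v)"
    if "u \<in> {f0, f1}" "v \<in> {g0, g1}" for u v
    using that f g by (intro insert.IH) auto
  have "(lp_norm p f * lp_norm p g) powr r = (power_sum p f * power_sum p g) powr q"
    unfolding lp_norm_eq_power_sum using r_div_p by (simp add: powr_powr mult.commute flip: powr_mult)
  also have "\<dots> = ((?a powr p + ?b powr p) * (?c powr p + ?e powr p)) powr q"
    using level p by (simp add: f(1) g(1) power_sum_stack lp_norm_powr)
  also have "\<dots> \<le> (?a * ?c) powr r + (?a * ?e + ?b * ?c) powr r + (?b * ?e) powr r"
    by (intro two_point r q qp crit lp_norm_nonneg)
  also have "\<dots> \<le> lp_norm r (convolution f0 g0) powr r
      + (lp_norm r (convolution f0 g1) + lp_norm r (convolution f1 g0)) powr r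
      + lp_norm r (convolution f1 g1) powr r"
    using r by (intro add_mono powr_mono2 IH) (auto simp: lp_norm_nonneg)
  also have "\<dots> \<le> power_sum r (convolution f0 g0)
        + power_sum r (\<lambda>x. convolution f0 g1 x + convolution f1 g0 x)
        + power_sum r (convolution f1 g1)"
    using r f g level
    by (intro add_mono reverse_Minkowski convolution_nonneg finite_support_convolution)
      (auto simp: lp_norm_powr on_level_def)
  also have "\<dots> = power_sum r (convolution f g)"
    unfolding f(1) g(1) using level by (simp add: power_sum_convolution_stack)
  also have "\<dots> = lp_norm r (convolution f g) powr r"
    using r by (simp add: lp_norm_powr)
  finally have "((lp_norm p f * lp_norm p g) powr r) powr (1 / r)
      \<le> (lp_norm r (convolution f g) powr r) powr (1 / r)"
    using r by (intro powr_mono2[of "1 / r"]) auto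
  moreover have "0 \<le> lp_norm p f * lp_norm p g"
    by (intro mult_nonneg_nonneg lp_norm_nonneg)
  ultimately show ?case
    using r by (simp add: powr_powr lp_norm_nonneg)
qed

section \<open>The sharp inequality\<close>

text \<open>
  The witness is the indicator of an edge of the cube: its self-convolution takes the values
  \<open>1, 2, 1\<close> at three collinear points and vanishes elsewhere.
\<close>
lemma exists_violation:
  fixes p r :: real
  assumes r: "0 < r" and less: "2 + 2 powr r < 4 powr (r / p)"
  shows "\<exists>f :: int ^ 'd \<Rightarrow> real. (\<forall>x. 0 \<le> f x) \<and> supported_in f discrete_cube \<and>
    lp_norm r (convolution f f) < lp_norm p f * lp_norm p f"
proof -
  obtain i :: 'd where True by simp
  define \<delta> :: "int ^ 'd \<Rightarrow> real" where "\<delta> = (\<lambda>x. if x = 0 then 1 else 0)"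
  have supp: "supported_in \<delta> {0}" by (simp add: \<delta>_def supported_in_def)
  have level: "on_level i 0 \<delta>" by (auto simp: on_level_def \<delta>_def)
  have conv: "convolution \<delta> \<delta> = \<delta>"
    using supp by (auto simp: convolution_point fun_eq_iff \<delta>_def)
  have sums: "power_sum s \<delta> = 1" "power_sum s (\<lambda>x. 2 * \<delta> x) = 2 powr s" for s
    using power_sum_eq_sum[of "{0}" \<delta> s] power_sum_eq_sum[of "{0}" "\<lambda>x. 2 * \<delta> x" s]
    by (auto simp: \<delta>_def)
  let ?f = "stack i \<delta> \<delta>"
  have nonneg: "\<forall>x. 0 \<le> ?f x"
    by (simp add: stack_def translate_def \<delta>_def)
  have "supported_in ?f discrete_cube"
    by (auto simp: stack_def translate_def \<delta>_def supported_in_def discrete_cube_def axis_def)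
  moreover have "lp_norm r (convolution ?f ?f) = (2 + 2 powr r) powr (1 / r)"
    by (simp add: lp_norm_eq_power_sum power_sum_convolution_stack level conv sums)
  moreover have "lp_norm p ?f * lp_norm p ?f = 4 powr (1 / p)"
    by (simp add: lp_norm_eq_power_sum power_sum_stack level sums flip: powr_mult)
  moreover have "(2 + 2 powr r) powr (1 / r) < (4 powr (r / p)) powr (1 / r)"
    using less r by (intro powr_less_mono2) (auto simp: add_nonneg_nonneg)
  moreover have "(4 powr (r / p)) powr (1 / r) = 4 powr (1 / p)"
    using r by (simp add: powr_powr)
  ultimately show ?thesis using nonneg by (intro exI[of _ ?f]) simp
qed

theorem theorem1p8:
  fixes r :: real
  assumes "0 < r" and "r < 1"
  shows "(\<forall>f g :: int ^ 'd \<Rightarrow> real.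
            (\<forall>x. 0 \<le> f x) \<longrightarrow> (\<forall>x. 0 \<le> g x) \<longrightarrow>
            supported_in f discrete_cube \<longrightarrow> supported_in g discrete_cube \<longrightarrow>
            lp_norm r (convolution f g)
              \<ge> lp_norm (critical_exponent r) f * lp_norm (critical_exponent r) g)
       \<and> (\<forall>p. 0 < p \<longrightarrow> p < critical_exponent r \<longrightarrow>
            (\<exists>f g :: int ^ 'd \<Rightarrow> real.
              (\<forall>x. 0 \<le> f x) \<and> (\<forall>x. 0 \<le> g x) \<and>
              supported_in f discrete_cube \<and> supported_in g discrete_cube \<and>
              \<not> (lp_norm r (convolution f g) \<ge> lp_norm p f * lp_norm p g)))"
proof -
  define q where "q = log 2 (2 + 2 powr r) / 2"
  have two_r: "0 < 2 powr r" "2 powr r < 2 powr 1"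
    using assms by (simp, intro powr_less_mono) auto
  have "log 2 2 \<le> log 2 (2 + 2 powr r)" "log 2 (2 + 2 powr r) \<le> log 2 (2 powr 2)"
    using two_r by (intro log_mono; simp add: add_pos_pos)+
  then have q: "1/2 \<le> q" "q \<le> 1"
    using log_powr_cancel[of 2 "2::real"] by (simp_all add: q_def)
  have qp: "q * critical_exponent r = r" and cr: "critical_exponent r = r / q"
    using q by (simp_all add: q_def critical_exponent_def)
  have crit: "4 powr q = 2 + 2 powr r"
  proof -
    have "4 powr q = (2 powr 2) powr q" by simp
    also have "\<dots> = 2 powr log 2 (2 + 2 powr r)"
      unfolding powr_powr by (simp add: q_def)
    also have "\<dots> = 2 + 2 powr r"
      by (rule powr_log_cancel) (simp_all add: add_pos_pos)
    finally show ?thesis .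
  qed
  have cube: "discrete_cube = (subcube UNIV :: (int ^ 'd) set)"
    by (simp add: discrete_cube_def subcube_def)
  show ?thesis
  proof (intro conjI allI impI)
    fix f g :: "int ^ 'd \<Rightarrow> real"
    assume "\<forall>x. 0 \<le> f x" "\<forall>x. 0 \<le> g x"
      and "supported_in f discrete_cube" "supported_in g discrete_cube"
    then show "lp_norm (critical_exponent r) f * lp_norm (critical_exponent r) g
        \<le> lp_norm r (convolution f g)"
      using assms q qp crit
      by (intro lp_norm_convolution_subcube[where S = UNIV and q = q]) (auto simp: cube)
  next
    fix p :: real assume p: "0 < p" "p < critical_exponent r"
    then have "q < r / p"
      using q by (simp add: cr field_simps)
    then have "2 + 2 powr r < 4 powr (r / p)"
      using powr_less_mono[of q "r / p" 4] crit by simp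
    then obtain f :: "int ^ 'd \<Rightarrow> real" where "\<forall>x. 0 \<le> f x" "supported_in f discrete_cube"
      "lp_norm r (convolution f f) < lp_norm p f * lp_norm p f"
      using exists_violation assms p by blast
    then show "\<exists>f g :: int ^ 'd \<Rightarrow> real.
        (\<forall>x. 0 \<le> f x) \<and> (\<forall>x. 0 \<le> g x) \<and>
        supported_in f discrete_cube \<and> supported_in g discrete_cube \<and>
        \<not> lp_norm p f * lp_norm p g \<le> lp_norm r (convolution f g)"
      by (intro exI[of _ f]) auto
  qed
qed

end
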